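(* Let $\mathbf M = \langle Q \cup \Sigma \cup \{0\}; \cdot\rangle$ be a finite total automatic algebra such that each letter $a\in\Sigma$ acts as a constant map on $Q$. Then $\mathbf M$ is dualizable.
   Context: **Automatic algebras.** An automatic algebra is an algebra with a single binary operation $\mathbf M = \langle Q \cup \Sigma \cup \{0\}; \cdot\rangle$, where $Q$ (states) and $\Sigma$ (letters) are disjoint sets and $0 \notin Q\cup\Sigma$, that encodes a partial (deterministic) automaton: each letter $a \in \Sigma$ acts as a partial map $Q \to Q$; for $q,r\in Q$ and $a \in \Sigma$ we have $q\cdot a = r$ iff $a$ sends $q$ to $r$; all other products are $0$. It is total if every letter acts as a totally defined map $Q\to Q$, i.e. $q\cdot a\neq 0$ for all $q\in Q$, $a\in\Sigma$. **Dualizability.** Let $\mathbf M$ be a finite algebra with universe $M$. A $k$-ary relation on $M$ ($k\ge 1$) is compatible with $\mathbf M$ if it is a subuniverse of $\mathbf M^k$. For $\mathbf A \in \mathbb{ISP}(\mathbf M)$ (isomorphic copies of subalgebras of powers of $\mathbf M$), view $\hom(\mathbf A,\mathbf M)\subseteq M^A$ with the subspace topology of the product topology ($M$ discrete), and with relations on $M$ interpreted pointwise. A map $f\colon \hom(\mathbf A,\mathbf M)\to M$ is an evaluation if there is $a\in A$ with $f(x)=x(a)$ for all $x$. The algebra $\mathbf M$ is dualizable if, for every $\mathbf A\in\mathbb{ISP}(\mathbf M)$, every continuous map $f\colon\hom(\mathbf A,\mathbf M)\to M$ that preserves all finitary compatible relations on $\mathbf M$ is an evaluation. *)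

theory Defs
  imports "HOL-Analysis.Analysis"
begin

text \<open>
  Algebras of the type considered here have one binary operation. Only the values of the operation
  on the universe matter. The empty set is allowed as a universe and as a subuniverse.
\<close>

record 'a binary_algebra =
  univ :: "'a set"
  prd :: "'a \<Rightarrow> 'a \<Rightarrow> 'a"

definition subuniverse :: "'a set \<Rightarrow> 'a binary_algebra \<Rightarrow> bool" where
  "subuniverse S A \<longleftrightarrow> S \<subseteq> univ A \<and> (\<forall>x\<in>S. \<forall>y\<in>S. prd A x y \<in> S)"

definition is_algebra :: "'a binary_algebra \<Rightarrow> bool" where
  "is_algebra A \<longleftrightarrow> subuniverse (univ A) A"

definition direct_power :: "'m binary_algebra \<Rightarrow> 'i set \<Rightarrow> ('i \<Rightarrow> 'm) binary_algebra" where
  "direct_power M I =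
     \<lparr>univ = I \<rightarrow>\<^sub>E univ M, prd = (\<lambda>x y. \<lambda>i\<in>I. prd M (x i) (y i))\<rparr>"

text \<open>
  Homomorphisms are made extensional, so that \<open>alg_hom A M\<close> is literally a subset of the
  product \<open>univ A \<rightarrow>\<^sub>E univ M\<close> on which the product topology lives.
\<close>

definition alg_hom :: "'a binary_algebra \<Rightarrow> 'b binary_algebra \<Rightarrow> ('a \<Rightarrow> 'b) set" where
  "alg_hom A B = {h \<in> univ A \<rightarrow>\<^sub>E univ B.
     \<forall>x\<in>univ A. \<forall>y\<in>univ A. h (prd A x y) = prd B (h x) (h y)}"

definition alg_iso :: "'a binary_algebra \<Rightarrow> 'b binary_algebra \<Rightarrow> bool" where
  "alg_iso A B \<longleftrightarrow> (\<exists>h\<in>alg_hom A B. bij_betw h (univ A) (univ B))"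

text \<open>
  Membership in \<open>ISP(M)\<close>. HOL cannot quantify over types inside a formula, so the type
  \<open>'i\<close> of the indices of the power is a parameter; a statement with \<open>'i\<close> free is a statement
  about all index sets.
\<close>

definition in_ISP :: "'i itself \<Rightarrow> 'm binary_algebra \<Rightarrow> 'a binary_algebra \<Rightarrow> bool" where
  "in_ISP TI M A \<longleftrightarrow> is_algebra A \<and>
     (\<exists>(I :: 'i set) S. subuniverse S (direct_power M I) \<and>
        alg_iso A ((direct_power M I)\<lparr>univ := S\<rparr>))"

definition compatible :: "'m binary_algebra \<Rightarrow> nat \<Rightarrow> (nat \<Rightarrow> 'm) set \<Rightarrow> bool" where
  "compatible M k R \<longleftrightarrow> k \<ge> 1 \<and> subuniverse R (direct_power M {..<k})"

definition preserves_relation ::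
  "'a binary_algebra \<Rightarrow> 'm binary_algebra \<Rightarrow> (('a \<Rightarrow> 'm) \<Rightarrow> 'm) \<Rightarrow> nat \<Rightarrow> (nat \<Rightarrow> 'm) set \<Rightarrow> bool" where
  "preserves_relation A M f k R \<longleftrightarrow>
     (\<forall>x. (\<forall>i<k. x i \<in> alg_hom A M) \<and> (\<forall>a\<in>univ A. (\<lambda>i\<in>{..<k}. x i a) \<in> R)
        \<longrightarrow> (\<lambda>i\<in>{..<k}. f (x i)) \<in> R)"

definition hom_topology ::
  "'a binary_algebra \<Rightarrow> 'm binary_algebra \<Rightarrow> ('a \<Rightarrow> 'm) topology" where
  "hom_topology A M =
     subtopology (product_topology (\<lambda>_. discrete_topology (univ M)) (univ A)) (alg_hom A M)"

definition is_evaluation ::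
  "'a binary_algebra \<Rightarrow> 'm binary_algebra \<Rightarrow> (('a \<Rightarrow> 'm) \<Rightarrow> 'm) \<Rightarrow> bool" where
  "is_evaluation A M f \<longleftrightarrow> (\<exists>a\<in>univ A. \<forall>x\<in>alg_hom A M. f x = x a)"

text \<open>
  Dualizability, relative to the type \<open>'a\<close> of the elements of \<open>A\<close> and the type \<open>'i\<close> of the
  indices of powers; leaving both types free expresses the quantification over all of
  \<open>ISP(M)\<close>. The codomain of \<open>f\<close> is \<open>univ M\<close>: this is part of \<open>continuous_map\<close>.
\<close>

definition dualizable :: "'a itself \<Rightarrow> 'i itself \<Rightarrow> 'm binary_algebra \<Rightarrow> bool" where
  "dualizable TA TI M \<longleftrightarrow>
     (\<forall>(A :: 'a binary_algebra) f.
        in_ISP TI M A \<and>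
        continuous_map (hom_topology A M) (discrete_topology (univ M)) f \<and>
        (\<forall>k R. compatible M k R \<longrightarrow> preserves_relation A M f k R)
        \<longrightarrow> is_evaluation A M f)"

text \<open>
  The letter \<open>a\<close> acts as the partial map \<open>q \<mapsto> q \<cdot> a\<close>, undefined where the product is \<open>z\<close>;
  \<open>z\<close> is the element written \<open>0\<close> in the literature.
\<close>

definition automatic_algebra :: "'m set \<Rightarrow> 'm set \<Rightarrow> 'm \<Rightarrow> 'm binary_algebra \<Rightarrow> bool" where
  "automatic_algebra Q \<Sigma> z M \<longleftrightarrow>
     univ M = Q \<union> \<Sigma> \<union> {z} \<and> Q \<inter> \<Sigma> = {} \<and> z \<notin> Q \<union> \<Sigma> \<and>
     (\<forall>q\<in>Q. \<forall>a\<in>\<Sigma>. prd M q a \<in> Q \<union> {z}) \<and>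
     (\<forall>x\<in>univ M. \<forall>y\<in>univ M. \<not> (x \<in> Q \<and> y \<in> \<Sigma>) \<longrightarrow> prd M x y = z)"

definition total_automatic_algebra :: "'m set \<Rightarrow> 'm set \<Rightarrow> 'm \<Rightarrow> 'm binary_algebra \<Rightarrow> bool" where
  "total_automatic_algebra Q \<Sigma> z M \<longleftrightarrow>
     automatic_algebra Q \<Sigma> z M \<and> (\<forall>q\<in>Q. \<forall>a\<in>\<Sigma>. prd M q a \<noteq> z)"

end

theory Submission
  imports Defs
begin

text \<open>
  Let \<open>X\<close> be the space of homomorphisms \<open>A \<rightarrow> M\<close> and let \<open>f\<close> be continuous and preserve all compatible
  relations. Two finiteness properties carry everything that follows. Compactness of \<open>X\<close> yields a
  finite \<open>G \<subseteq> A\<close> such that \<open>f x\<close> depends only on the restriction of \<open>x\<close> to \<open>G\<close>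
  (\<open>continuous_imp_finitely_supported\<close>). For each finite \<open>F \<subseteq> X\<close>, the relation consisting of the
  tuples \<open>(x a)\<close>, \<open>x \<in> F\<close>, with \<open>a\<close> ranging over \<open>A\<close>, is compatible; so some \<open>a\<close> satisfies \<open>f x = x a\<close>
  on \<open>F\<close> (\<open>preserving_imp_locally_evaluation\<close>). Such an \<open>a\<close> is said here to agree with \<open>f\<close> on \<open>F\<close>.
  It depends on \<open>F\<close>, and the task is to find one that serves all of \<open>X\<close>.

  The method is to build homomorphisms to be put into \<open>F\<close>, so that agreement with \<open>f\<close> there says
  a lot about \<open>a\<close>. Since letters act as constants \<open>c\<close>, a map \<open>h\<close> is a homomorphism iff
  \<open>h (u \<cdot> v) = c (h v)\<close> when \<open>h u\<close> is a state and \<open>h v\<close> a letter, and \<open>h (u \<cdot> v) = 0\<close> otherwise. Hence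
  one may restrict a homomorphism \<open>x\<close> to the elements that are letters, or states, at all points of a
  set \<open>V \<ni> x\<close>, setting the other values to \<open>0\<close>, and one may alter the values of those elements as
  long as states stay states, letters stay letters, and products follow their last factor
  (\<open>relabelled_hom\<close>).

  If \<open>f\<close> takes a letter as value, a homomorphism that is nonzero only on \<open>G\<close> forces \<open>a \<in> G\<close>, and
  finiteness of \<open>G\<close> finishes the proof (\<open>letter_value_imp_evaluation\<close>). Otherwise \<open>f\<close> takes values
  in \<open>Q \<union> {0}\<close>. A finite \<open>F\<close> then already forces \<open>a = f\<close> wherever \<open>f\<close> is nonzero
  (\<open>finite_test_set\<close>), but \<open>a\<close> may be nonzero at further points. It remains to cut the support of \<open>a\<close>
  down to that of \<open>f\<close> by multiplying with letters. Let \<open>W\<close> be the set of elements that are letters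
  throughout the support of \<open>f\<close>, and \<open>C\<close> the set of elements that are states throughout it and become
  indistinguishable from \<open>a\<close>, as far as being a state is concerned, after multiplication by finitely
  many members of \<open>W\<close>.
  The restriction of a point of the support to \<open>W \<union> C\<close> is again in the support
  (\<open>restrict_to_companions_in_support\<close>), and this makes the support of \<open>f\<close> exactly the set of points at
  which the members of \<open>G \<inter> W\<close> are letters and those of \<open>G \<inter> C\<close> are states. That condition is
  expressed by the single product \<open>e = a t\<^sub>1 \<dots> t\<^sub>n\<close> of \<open>a\<close> with finitely many members of \<open>W\<close>. One more
  factor \<open>t \<in> W\<close>, with \<open>c (x t) = f x\<close> on the support, restores the values, and \<open>f\<close> is the
  evaluation at \<open>e t\<close>.
\<close>

section \<open>Homomorphisms into an algebra of constant letters\<close>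

locale constant_letters =
  fixes M :: "'m binary_algebra" and Q \<Sigma> :: "'m set" and z :: 'm and c :: "'m \<Rightarrow> 'm"
    and A :: "'a binary_algebra"
  assumes automatic: "automatic_algebra Q \<Sigma> z M"
    and prd_letter: "\<And>q t. q \<in> Q \<Longrightarrow> t \<in> \<Sigma> \<Longrightarrow> prd M q t = c t"
    and letter_value: "\<And>q t. q \<in> Q \<Longrightarrow> t \<in> \<Sigma> \<Longrightarrow> c t \<in> Q"
    and algebra: "is_algebra A"
begin

abbreviation X :: "('a \<Rightarrow> 'm) set" where "X \<equiv> alg_hom A M"

lemma univ_M: "univ M = Q \<union> \<Sigma> \<union> {z}"
  and disjoint: "q \<in> Q \<Longrightarrow> q \<notin> \<Sigma>" "t \<in> \<Sigma> \<Longrightarrow> t \<notin> Q" "z \<notin> Q" "z \<notin> \<Sigma>"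
  using automatic by (auto simp: automatic_algebra_def)

lemma prd_M:
  "\<lbrakk>m \<in> univ M; n \<in> univ M\<rbrakk> \<Longrightarrow> prd M m n = (if m \<in> Q \<and> n \<in> \<Sigma> then c n else z)"
  using automatic prd_letter by (auto simp: automatic_algebra_def)

lemma prd_closed: "\<lbrakk>u \<in> univ A; v \<in> univ A\<rbrakk> \<Longrightarrow> prd A u v \<in> univ A"
  using algebra by (auto simp: is_algebra_def subuniverse_def)

lemma homI:
  assumes "\<And>a. a \<in> univ A \<Longrightarrow> h a \<in> univ M"
    and "\<And>u v. \<lbrakk>u \<in> univ A; v \<in> univ A\<rbrakk> \<Longrightarrow>
      h (prd A u v) = (if h u \<in> Q \<and> h v \<in> \<Sigma> then c (h v) else z)"
  shows "restrict h (univ A) \<in> X"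
  using assms by (auto simp: alg_hom_def prd_closed prd_M)

lemma hom_prd:
  "\<lbrakk>x \<in> X; u \<in> univ A; v \<in> univ A\<rbrakk> \<Longrightarrow>
    x (prd A u v) = (if x u \<in> Q \<and> x v \<in> \<Sigma> then c (x v) else z)"
  by (auto simp: alg_hom_def prd_M PiE_iff)

lemma hom_mem: "\<lbrakk>x \<in> X; a \<in> univ A\<rbrakk> \<Longrightarrow> x a \<in> univ M"
  by (auto simp: alg_hom_def)

lemma hom_prd_state:
  "\<lbrakk>x \<in> X; u \<in> univ A; v \<in> univ A\<rbrakk> \<Longrightarrow> x (prd A u v) \<in> Q \<longleftrightarrow> x u \<in> Q \<and> x v \<in> \<Sigma>"
  by (auto simp: hom_prd letter_value disjoint)

lemma hom_prd_not_letter: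
  "\<lbrakk>x \<in> X; u \<in> univ A; v \<in> univ A\<rbrakk> \<Longrightarrow> x (prd A u v) \<notin> \<Sigma>"
  by (auto simp: hom_prd disjoint dest: letter_value)

lemma zero_hom: "(\<lambda>a\<in>univ A. z) \<in> X"
  by (rule homI) (auto simp: univ_M disjoint)

text \<open>
  The element is the left-normed product of \<open>a\<close> with the members of \<open>T\<close>: multiplying by letters
  intersects the sets of points at which the factors have the right type.
\<close>

lemma exists_iterated_product:
  assumes "finite T" "T \<subseteq> univ A" "a \<in> univ A"
  shows "\<exists>e\<in>univ A. \<forall>x\<in>X. x e \<in> Q \<longleftrightarrow> x a \<in> Q \<and> (\<forall>t\<in>T. x t \<in> \<Sigma>)"
  using assms(1,2)
proof (induction T rule: finite_induct)
  case empty
  then show ?case using assms(3) by auto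
next
  case (insert t T)
  then obtain e where "e \<in> univ A" "\<forall>x\<in>X. x e \<in> Q \<longleftrightarrow> x a \<in> Q \<and> (\<forall>t\<in>T. x t \<in> \<Sigma>)"
    by auto
  then show ?case
    using insert.prems by (intro bexI[of _ "prd A e t"]) (auto simp: hom_prd_state prd_closed)
qed

definition letters_on :: "('a \<Rightarrow> 'm) set \<Rightarrow> 'a set" where
  "letters_on V = {a \<in> univ A. \<forall>x\<in>V. x a \<in> \<Sigma>}"

definition states_on :: "('a \<Rightarrow> 'm) set \<Rightarrow> 'a set" where
  "states_on V = {a \<in> univ A. \<forall>x\<in>V. x a \<in> Q}"

text \<open>
  Joining each state \<open>s\<close> on \<open>V\<close> to its products \<open>s \<cdot> t\<close> with letters on \<open>V\<close> makes \<open>states_on V\<close> a graph;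
  the sets described here are the unions of its connected components.
\<close>

definition act_closed :: "('a \<Rightarrow> 'm) set \<Rightarrow> 'a set \<Rightarrow> bool" where
  "act_closed V S \<longleftrightarrow> S \<subseteq> states_on V \<and>
     (\<forall>s\<in>states_on V. \<forall>t\<in>letters_on V. s \<in> S \<longleftrightarrow> prd A s t \<in> S)"

lemma prd_states_on:
  assumes "V \<subseteq> X" "u \<in> univ A" "v \<in> univ A"
  shows "prd A u v \<in> states_on V \<longleftrightarrow> u \<in> states_on V \<and> v \<in> letters_on V"
  using assms hom_prd_state prd_closed by (fastforce simp: states_on_def letters_on_def)

lemma prd_not_letters_on:
  assumes "V \<subseteq> X" "V \<noteq> {}" "u \<in> univ A" "v \<in> univ A"
  shows "prd A u v \<notin> letters_on V"
  using assms hom_prd_not_letter by (fastforce simp: letters_on_def)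

lemma act_closed_states_on: "V \<subseteq> X \<Longrightarrow> act_closed V (states_on V)"
  using prd_states_on by (auto simp: act_closed_def states_on_def letters_on_def)

lemma act_closed_diff: "V \<subseteq> X \<Longrightarrow> act_closed V S \<Longrightarrow> act_closed V (states_on V - S)"
  using prd_states_on by (fastforce simp: act_closed_def states_on_def letters_on_def)

text \<open>
  The basic construction of homomorphisms. If a product \<open>u \<cdot> v\<close> is a state on \<open>V\<close>, then \<open>u\<close> is a state
  and \<open>v\<close> a letter on \<open>V\<close>, while a product is never a letter; so the elements that keep a nonzero value
  are closed both under nonzero products and under taking factors.
\<close>

lemma relabelled_hom:
  assumes V: "V \<subseteq> X" "V \<noteq> {}" and S: "act_closed V S"
    and hQ: "\<And>s. s \<in> S \<Longrightarrow> h s \<in> Q"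
    and hL: "\<And>t. t \<in> letters_on V \<Longrightarrow> h t \<in> \<Sigma>"
    and hp: "\<And>s t. \<lbrakk>s \<in> S; t \<in> letters_on V\<rbrakk> \<Longrightarrow> h (prd A s t) = c (h t)"
  shows "(\<lambda>a\<in>univ A. if a \<in> letters_on V \<union> S then h a else z) \<in> X"
proof (rule homI)
  fix a
  show "(if a \<in> letters_on V \<union> S then h a else z) \<in> univ M"
    using hQ hL by (auto simp: univ_M)
next
  let ?y = "\<lambda>a. if a \<in> letters_on V \<union> S then h a else z"
  fix u v assume uv: "u \<in> univ A" "v \<in> univ A"
  have SV: "S \<subseteq> states_on V" using S by (simp add: act_closed_def)
  have Q: "?y u \<in> Q \<longleftrightarrow> u \<in> S" using hQ hL disjoint by auto
  have L: "?y v \<in> \<Sigma> \<longleftrightarrow> v \<in> letters_on V" using hQ hL disjoint by auto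
  have P: "prd A u v \<in> letters_on V \<union> S \<longleftrightarrow> u \<in> S \<and> v \<in> letters_on V"
    using prd_not_letters_on[OF V uv] prd_states_on[OF V(1) uv] S SV
    unfolding act_closed_def by blast
  show "?y (prd A u v) = (if ?y u \<in> Q \<and> ?y v \<in> \<Sigma> then c (?y v) else z)"
    unfolding Q L using P hp by auto
qed

definition restrict_hom :: "('a \<Rightarrow> 'm) set \<Rightarrow> 'a set \<Rightarrow> ('a \<Rightarrow> 'm) \<Rightarrow> 'a \<Rightarrow> 'm" where
  "restrict_hom V S x = (\<lambda>a\<in>univ A. if a \<in> letters_on V \<union> S then x a else z)"

lemma restrict_hom:
  assumes "V \<subseteq> X" "x \<in> V" "act_closed V S"
  shows "restrict_hom V S x \<in> X"
  unfolding restrict_hom_def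
proof (rule relabelled_hom[OF assms(1) _ assms(3)])
  have S: "S \<subseteq> states_on V" and x: "x \<in> X" using assms by (auto simp: act_closed_def)
  show "V \<noteq> {}" using assms by auto
  show Q: "x s \<in> Q" if "s \<in> S" for s using that S assms by (auto simp: states_on_def)
  show L: "x t \<in> \<Sigma>" if "t \<in> letters_on V" for t using that assms by (auto simp: letters_on_def)
  show "x (prd A s t) = c (x t)" if st: "s \<in> S" "t \<in> letters_on V" for s t
  proof -
    have "s \<in> univ A" "t \<in> univ A" using st S by (auto simp: states_on_def letters_on_def)
    then show ?thesis using hom_prd[OF x] Q L st by simp
  qed
qed

text \<open>
  One homomorphism \<open>y\<close> that behaves like all of \<open>V\<close> at once: agreement with \<open>q\<close> at \<open>y\<close> forces agreement
  with \<open>q\<close> on \<open>V\<close>. Elements that are constant on \<open>V\<close> keep their value, and each state that is not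
  constant on \<open>V\<close> receives one fixed value \<open>q' \<noteq> q\<close>. A product inherits its value from its last factor,
  so the letters \<open>t\<close> for which \<open>c (x t)\<close> varies with \<open>x \<in> V\<close> must receive a letter with constant
  value \<open>q'\<close>.
\<close>

lemma separating_hom:
  assumes V: "V \<subseteq> X" "V \<noteq> {}" and q: "q \<in> Q"
  shows "\<exists>y\<in>X. (\<forall>a\<in>univ A. \<forall>m. (\<forall>x\<in>V. x a = m) \<longrightarrow> y a = m) \<and>
               (\<forall>a\<in>univ A. y a = q \<longrightarrow> (\<forall>x\<in>V. x a = q))"
proof -
  obtain x0 where x0: "x0 \<in> V" using V by auto
  define K where "K = {a. \<forall>x\<in>V. x a = x0 a}"
  define Kc where "Kc = {a. \<forall>x\<in>V. c (x a) = c (x0 a)}"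
  \<comment> \<open>If all letters have constant value \<open>q\<close>, no letter is relabelled, and any other state will do
    as \<open>q'\<close>; if \<open>q\<close> is the only state, nothing is relabelled at all.\<close>
  obtain q' \<sigma> where q'1: "\<exists>t\<in>\<Sigma>. c t \<noteq> q \<Longrightarrow> \<sigma> \<in> \<Sigma> \<and> c \<sigma> = q'"
    and q'2: "\<exists>r\<in>Q. r \<noteq> q \<Longrightarrow> q' \<in> Q \<and> q' \<noteq> q"
  proof (cases "\<exists>t\<in>\<Sigma>. c t \<noteq> q")
    case True
    then obtain t where "t \<in> \<Sigma>" "c t \<noteq> q" by auto
    then show thesis using that[of t "c t"] letter_value[OF q] by auto
  next
    case False
    then show thesis using that by (metis (full_types))
  qed
  define h where "h a = (if a \<in> K then x0 a else if a \<in> states_on V then q'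
      else if a \<in> Kc then x0 a else \<sigma>)" for a
  have nonconst_state: "q' \<in> Q \<and> q' \<noteq> q" if a: "a \<in> states_on V" "a \<notin> K" for a
  proof -
    obtain x where x: "x \<in> V" "x a \<noteq> x0 a" using a by (auto simp: K_def)
    then have "x a \<in> Q" "x0 a \<in> Q" using a x0 by (auto simp: states_on_def)
    then show ?thesis using q'2 x by metis
  qed
  have nonconst_letter: "\<sigma> \<in> \<Sigma> \<and> c \<sigma> = q'" if t: "t \<in> letters_on V" "t \<notin> Kc" for t
  proof -
    obtain x where x: "x \<in> V" "c (x t) \<noteq> c (x0 t)" using t by (auto simp: Kc_def)
    then have "x t \<in> \<Sigma>" "x0 t \<in> \<Sigma>" using t x0 by (auto simp: letters_on_def)
    then show ?thesis using q'1 x by metis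
  qed
  have letter_not_state: "t \<notin> states_on V" if "t \<in> letters_on V" for t
    using that x0 disjoint by (auto simp: letters_on_def states_on_def)
  have K_sub: "K \<subseteq> Kc" by (auto simp: K_def Kc_def)
  have hQ: "h s \<in> Q" if "s \<in> states_on V" for s
    using that nonconst_state x0 by (auto simp: h_def states_on_def)
  have hL: "h t \<in> \<Sigma>" if "t \<in> letters_on V" for t
    using that nonconst_letter letter_not_state x0 by (auto simp: h_def letters_on_def)
  have hp: "h (prd A s t) = c (h t)" if st: "s \<in> states_on V" "t \<in> letters_on V" for s t
  proof -
    have st': "s \<in> univ A" "t \<in> univ A" using st by (auto simp: states_on_def letters_on_def)
    have val: "x (prd A s t) = c (x t)" if "x \<in> V" for x
      using hom_prd[of x s t] st st' that V(1) by (auto simp: states_on_def letters_on_def)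
    have "prd A s t \<in> K \<longleftrightarrow> t \<in> Kc" using val x0 by (auto simp: K_def Kc_def)
    moreover have "prd A s t \<in> states_on V"
      using st prd_states_on[OF V(1)] by (auto simp: states_on_def letters_on_def)
    moreover have "t \<notin> states_on V" using letter_not_state st by blast
    ultimately show ?thesis
      using st val[OF x0] nonconst_letter[OF st(2)] K_sub by (auto simp: h_def)
  qed
  define y where "y = (\<lambda>a\<in>univ A. if a \<in> letters_on V \<union> states_on V then h a else z)"
  have "y \<in> X" unfolding y_def
    by (intro relabelled_hom V act_closed_states_on hQ hL hp)
  moreover have "y a = m" if "a \<in> univ A" "\<forall>x\<in>V. x a = m" for a m
  proof -
    have "x0 a = m" using that x0 by blast
    then have K: "a \<in> K" "x0 a = m" using that by (simp_all add: K_def)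
    have "m \<in> univ M" using K that x0 V hom_mem by auto
    then show ?thesis using that K by (auto simp: y_def h_def letters_on_def states_on_def univ_M)
  qed
  moreover have "\<forall>x\<in>V. x a = q" if a: "a \<in> univ A" "y a = q" for a
  proof -
    have S: "a \<in> states_on V"
      using a q hL disjoint by (auto simp: y_def split: if_splits)
    then have "a \<in> K" using a nonconst_state by (auto simp: y_def h_def split: if_splits)
    then show ?thesis using a S by (auto simp: y_def h_def K_def)
  qed
  ultimately show ?thesis by blast
qed

end

section \<open>Locally evaluating maps with finite support are evaluations\<close>

locale local_evaluation = constant_letters M Q \<Sigma> z c A
  for M :: "'m binary_algebra" and Q \<Sigma> :: "'m set" and z :: 'm and c :: "'m \<Rightarrow> 'm"
    and A :: "'a binary_algebra" +
  fixes f :: "('a \<Rightarrow> 'm) \<Rightarrow> 'm" and G :: "'a set"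
  assumes finite_M: "finite (univ M)"
    and G: "finite G" "G \<subseteq> univ A"
    and supported: "\<And>x y. \<lbrakk>x \<in> X; y \<in> X; \<forall>g\<in>G. x g = y g\<rbrakk> \<Longrightarrow> f x = f y"
    and locally: "\<And>F. \<lbrakk>finite F; F \<subseteq> X\<rbrakk> \<Longrightarrow> \<exists>a\<in>univ A. \<forall>x\<in>F. f x = x a"
begin

lemma f_mem: "x \<in> X \<Longrightarrow> f x \<in> univ M"
  using locally[of "{x}"] hom_mem by auto

text \<open>
  As \<open>G\<close> is finite, the failure of all its members to represent \<open>f\<close> is witnessed by finitely many
  homomorphisms. Once these are among the test points, an agreeing element lies outside \<open>G\<close>.
\<close>

lemma finite_refutation:
  assumes "\<not> is_evaluation A M f"
  obtains F where "finite F" "F \<subseteq> X" "\<And>g. g \<in> G \<Longrightarrow> \<exists>x\<in>F. f x \<noteq> x g"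
proof -
  have "\<forall>g\<in>G. \<exists>x. x \<in> X \<and> f x \<noteq> x g" using assms G by (auto simp: is_evaluation_def)
  then obtain w where "\<forall>g\<in>G. w g \<in> X \<and> f (w g) \<noteq> w g g" by metis
  then show thesis using G by (intro that[of "w ` G"]) auto
qed

text \<open>
  A homomorphism that annihilates all products may be set to \<open>0\<close> outside \<open>G\<close> without changing the
  value of \<open>f\<close>. Any element that agrees with \<open>f\<close> at the resulting point is nonzero there, hence is
  in \<open>G\<close>.
\<close>

lemma nonzero_at_null_hom:
  assumes x: "x \<in> X" and nz: "f x \<noteq> z"
    and null: "\<And>u v. \<lbrakk>u \<in> univ A; v \<in> univ A\<rbrakk> \<Longrightarrow> \<not> (x u \<in> Q \<and> x v \<in> \<Sigma>)"
  shows "is_evaluation A M f"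
proof (rule ccontr)
  assume "\<not> is_evaluation A M f"
  then obtain F where F: "finite F" "F \<subseteq> X" "\<And>g. g \<in> G \<Longrightarrow> \<exists>x\<in>F. f x \<noteq> x g"
    using finite_refutation by metis
  define y where "y = (\<lambda>a\<in>univ A. if a \<in> G then x a else z)"
  have null': "x (prd A u v) = z" if "u \<in> univ A" "v \<in> univ A" for u v
    using that null x by (auto simp: hom_prd)
  have "y \<in> X" unfolding y_def
  proof (rule homI)
    fix a assume "a \<in> univ A"
    then show "(if a \<in> G then x a else z) \<in> univ M" using hom_mem[OF x] by (simp add: univ_M)
  next
    fix u v assume uv: "u \<in> univ A" "v \<in> univ A"
    show "(if prd A u v \<in> G then x (prd A u v) else z) =
      (if (if u \<in> G then x u else z) \<in> Q \<and> (if v \<in> G then x v else z) \<in> \<Sigma>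
       then c (if v \<in> G then x v else z) else z)"
      using null[OF uv] null'[OF uv] disjoint by auto
  qed
  moreover have "f y = f x"
    using G by (intro supported x \<open>y \<in> X\<close>) (auto simp: y_def)
  moreover obtain a where a: "a \<in> univ A" "\<forall>x\<in>insert y F. f x = x a"
    using locally[of "insert y F"] F \<open>y \<in> X\<close> by auto
  ultimately have "a \<in> G" using nz by (auto simp: y_def split: if_splits)
  then show False using F(3) a(2) by auto
qed

text \<open>
  No product takes a letter as value, so the letter values of a homomorphism \<open>x\<close> alone form a
  homomorphism \<open>y\<close>, which annihilates all products. An element that agrees with \<open>f\<close> at both has the
  same letter as value at \<open>x\<close> and \<open>y\<close>.
\<close>

lemma letter_value_imp_evaluation:
  assumes x: "x \<in> X" and L: "f x \<in> \<Sigma>"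
  shows "is_evaluation A M f"
proof -
  define y where "y = (\<lambda>a\<in>univ A. if x a \<in> \<Sigma> then x a else z)"
  have y: "y \<in> X" unfolding y_def
  proof (rule homI)
    fix u v assume "u \<in> univ A" "v \<in> univ A"
    then have "x (prd A u v) \<notin> \<Sigma>" by (rule hom_prd_not_letter[OF x])
    then show "(if x (prd A u v) \<in> \<Sigma> then x (prd A u v) else z) =
      (if (if x u \<in> \<Sigma> then x u else z) \<in> Q \<and> (if x v \<in> \<Sigma> then x v else z) \<in> \<Sigma>
       then c (if x v \<in> \<Sigma> then x v else z) else z)"
      using disjoint by simp
  qed (simp add: univ_M)
  obtain a where "a \<in> univ A" "f x = x a" "f y = y a"
    using locally[of "{x, y}"] x y by auto
  then have "f y \<noteq> z" using L disjoint by (auto simp: y_def)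
  then show ?thesis
    by (intro nonzero_at_null_hom[OF y]) (auto simp: y_def disjoint)
qed

text \<open>
  There are only finitely many restrictions of homomorphisms to \<open>G\<close>, and \<open>f\<close> is constant on the set
  of homomorphisms with a given restriction; \<open>separating_hom\<close> supplies one test point for each of
  these sets. The test point has that same restriction, because members of \<open>G\<close> are constant there.
\<close>

lemma finite_test_set:
  obtains F where "finite F" "F \<subseteq> X"
    "\<And>a x. \<lbrakk>a \<in> univ A; \<forall>y\<in>F. f y = y a; x \<in> X; f x \<in> Q\<rbrakk> \<Longrightarrow> f x = x a"
proof -
  define fibre where "fibre p = {x\<in>X. restrict x G = p}" for p
  define \<V> where "\<V> = fibre ` (\<lambda>x. restrict x G) ` {x\<in>X. f x \<in> Q}"
  have "(\<lambda>x. restrict x G) ` X \<subseteq> G \<rightarrow>\<^sub>E univ M"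
    using G hom_mem by auto
  then have "finite ((\<lambda>x. restrict x G) ` X)"
    using finite_subset finite_PiE G finite_M by metis
  then have fin: "finite \<V>"
    by (rule finite_surj[of _ _ fibre]) (auto simp: \<V>_def)
  have "\<forall>V\<in>\<V>. \<exists>y\<in>X. \<forall>a\<in>univ A. f y = y a \<longrightarrow> (\<forall>x\<in>V. f x = x a)"
  proof
    fix V assume "V \<in> \<V>"
    then obtain x0 where x0: "x0 \<in> X" "f x0 \<in> Q" and V: "V = fibre (restrict x0 G)"
      by (auto simp: \<V>_def)
    have agree: "x g = x0 g" if "x \<in> V" "g \<in> G" for x g
    proof -
      have "restrict x G = restrict x0 G" using that by (simp add: V fibre_def)
      then show ?thesis using that(2) by (metis restrict_apply')
    qed
    have sub: "V \<subseteq> X" "V \<noteq> {}" using x0 by (auto simp: V fibre_def)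
    have fV: "f x = f x0" if "x \<in> V" for x
      using that agree sub x0 by (intro supported) auto
    obtain y where y: "y \<in> X" "\<forall>a\<in>univ A. \<forall>m. (\<forall>x\<in>V. x a = m) \<longrightarrow> y a = m"
      "\<forall>a\<in>univ A. y a = f x0 \<longrightarrow> (\<forall>x\<in>V. x a = f x0)"
      using separating_hom[OF sub x0(2)] by auto
    have "f y = f x0" using y agree G x0 by (intro supported) auto
    then show "\<exists>y\<in>X. \<forall>a\<in>univ A. f y = y a \<longrightarrow> (\<forall>x\<in>V. f x = x a)"
      using y fV by (metis (no_types, lifting))
  qed
  then obtain w where w: "\<forall>V\<in>\<V>. w V \<in> X \<and> (\<forall>a\<in>univ A. f (w V) = w V a \<longrightarrow> (\<forall>x\<in>V. f x = x a))"
    by metis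
  show thesis
  proof (rule that[of "w ` \<V>"])
    show "finite (w ` \<V>)" using fin by simp
    show "w ` \<V> \<subseteq> X" using w by auto
    fix a x assume a: "a \<in> univ A" "\<forall>y\<in>w ` \<V>. f y = y a" and x: "x \<in> X" "f x \<in> Q"
    have "fibre (restrict x G) \<in> \<V>" "x \<in> fibre (restrict x G)"
      using x by (auto simp: \<V>_def fibre_def)
    then show "f x = x a" using w a by auto
  qed
qed

definition products :: "'a set" where
  "products = {prd A s t |s t. s \<in> univ A \<and> t \<in> univ A}"

text \<open>
  An element that is neither a product nor in \<open>G\<close> can be moved from one state to another without
  affecting anything else: states enter products only through being states.
\<close>

lemma product_test_hom:
  assumes x: "x \<in> X" and fx: "f x \<in> Q"
  shows "\<exists>y\<in>X. \<forall>a\<in>univ A. f y = y a \<longrightarrow> a \<in> G \<or> a \<in> products \<or> Q = {f x}"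
proof (cases "Q = {f x}")
  case True
  then show ?thesis using x by auto
next
  case False
  then obtain q' where q': "q' \<in> Q" "q' \<noteq> f x" using fx by auto
  define B where "B = {a. a \<notin> G \<and> x a \<in> Q \<and> a \<notin> products}"
  define y where "y = (\<lambda>a\<in>univ A. if a \<in> B then q' else x a)"
  have B: "prd A u v \<notin> B" if "u \<in> univ A" "v \<in> univ A" for u v
    using that by (auto simp: B_def products_def)
  have "y \<in> X" unfolding y_def
  proof (rule homI)
    fix a assume "a \<in> univ A"
    then show "(if a \<in> B then q' else x a) \<in> univ M" using q' hom_mem[OF x] by (simp add: univ_M)
  next
    fix u v assume uv: "u \<in> univ A" "v \<in> univ A"
    have "(if u \<in> B then q' else x u) \<in> Q \<longleftrightarrow> x u \<in> Q"
      using q' by (auto simp: B_def)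
    moreover have "(if v \<in> B then q' else x v) \<in> \<Sigma> \<longleftrightarrow> x v \<in> \<Sigma>"
      using q' disjoint by (auto simp: B_def)
    moreover have "v \<notin> B" if "x v \<in> \<Sigma>" using that disjoint by (auto simp: B_def)
    ultimately show "(if prd A u v \<in> B then q' else x (prd A u v)) =
      (if (if u \<in> B then q' else x u) \<in> Q \<and> (if v \<in> B then q' else x v) \<in> \<Sigma>
       then c (if v \<in> B then q' else x v) else z)"
      using B[OF uv] hom_prd[OF x uv] by auto
  qed
  moreover have "f y = f x"
    using G by (intro supported x \<open>y \<in> X\<close>) (auto simp: y_def B_def)
  ultimately show ?thesis
    using q' fx by (intro bexI[of _ y]) (auto simp: y_def B_def split: if_splits)
qed

definition support :: "('a \<Rightarrow> 'm) set" where
  "support = {x \<in> X. f x \<noteq> z}"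

lemma support_subset: "support \<subseteq> X"
  by (auto simp: support_def)

text \<open>
  A semantic form of the connected component of \<open>a\<close> in the graph of products by letters on the
  support: words \<open>s \<tau> = a \<tau>'\<close> witnessing connectedness are replaced by what they imply, namely that
  where all letters of \<open>\<tau>\<close> and \<open>\<tau>'\<close> take letter values, \<open>s\<close> is a state iff \<open>a\<close> is one. The order of
  the letters then no longer matters.
\<close>

definition companions :: "'a \<Rightarrow> 'a set" where
  "companions a = {s \<in> states_on support. \<exists>T. finite T \<and> T \<subseteq> letters_on support \<and>
     (\<forall>x\<in>X. (\<forall>t\<in>T. x t \<in> \<Sigma>) \<longrightarrow> (x s \<in> Q \<longleftrightarrow> x a \<in> Q))}"

lemma act_closed_companions: "act_closed support (companions a)"
  unfolding act_closed_def
proof (intro conjI ballI)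
  show "companions a \<subseteq> states_on support" by (auto simp: companions_def)
  fix s t assume s: "s \<in> states_on support" and t: "t \<in> letters_on support"
  \<comment> \<open>A witness for \<open>s\<close> becomes one for \<open>s \<cdot> t\<close>, and conversely, by including \<open>t\<close>.\<close>
  define ctrl where "ctrl s T \<longleftrightarrow> finite T \<and> T \<subseteq> letters_on support \<and>
    (\<forall>x\<in>X. (\<forall>t\<in>T. x t \<in> \<Sigma>) \<longrightarrow> (x s \<in> Q \<longleftrightarrow> x a \<in> Q))" for s T
  have A: "s \<in> univ A" "t \<in> univ A" using s t by (auto simp: states_on_def letters_on_def)
  have st: "prd A s t \<in> states_on support"
    using prd_states_on[OF support_subset A] s t by auto
  have C: "s' \<in> companions a \<longleftrightarrow> (\<exists>T. ctrl s' T)" if "s' \<in> states_on support" for s'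
    using that by (simp add: companions_def ctrl_def)
  have act: "x (prd A s t) \<in> Q \<longleftrightarrow> x s \<in> Q" if "x \<in> X" "x t \<in> \<Sigma>" for x
    using hom_prd_state[OF that(1) A] that(2) by simp
  have "ctrl s (insert t T) \<longleftrightarrow> ctrl (prd A s t) (insert t T)" for T
    unfolding ctrl_def using act by auto
  moreover have "ctrl s' (insert t T)" if "ctrl s' T" for s' T
    using that t by (auto simp: ctrl_def)
  ultimately show "s \<in> companions a \<longleftrightarrow> prd A s t \<in> companions a"
    unfolding C[OF s] C[OF st] by blast
qed

lemma common_control:
  assumes "finite H" "H \<subseteq> companions a"
  shows "\<exists>T. finite T \<and> T \<subseteq> letters_on support \<and>
    (\<forall>g\<in>H. \<forall>x\<in>X. (\<forall>t\<in>T. x t \<in> \<Sigma>) \<longrightarrow> (x g \<in> Q \<longleftrightarrow> x a \<in> Q))"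
proof -
  have "\<forall>g\<in>H. \<exists>T. finite T \<and> T \<subseteq> letters_on support \<and>
      (\<forall>x\<in>X. (\<forall>t\<in>T. x t \<in> \<Sigma>) \<longrightarrow> (x g \<in> Q \<longleftrightarrow> x a \<in> Q))"
    using assms(2) by (auto simp: companions_def)
  then obtain T where "\<forall>g\<in>H. finite (T g) \<and> T g \<subseteq> letters_on support \<and>
      (\<forall>x\<in>X. (\<forall>t\<in>T g. x t \<in> \<Sigma>) \<longrightarrow> (x g \<in> Q \<longleftrightarrow> x a \<in> Q))"
    by metis
  then show ?thesis
    using assms(1) by (intro exI[of _ "\<Union>g\<in>H. T g"] conjI) blast+
qed

context
  assumes no_letter: "\<And>x. x \<in> X \<Longrightarrow> f x \<notin> \<Sigma>"
begin

lemma support_iff: "x \<in> X \<Longrightarrow> x \<in> support \<longleftrightarrow> f x \<in> Q"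
  using no_letter f_mem disjoint by (fastforce simp: support_def univ_M)

lemma agreeing_is_state:
  assumes "a \<in> univ A" "\<forall>x\<in>support. x a = f x"
  shows "a \<in> states_on support"
  using assms support_iff by (auto simp: states_on_def support_def)

text \<open>
  Restricting \<open>x0\<close> instead to the complement of the companions kills \<open>a0\<close>, which is nonzero on the whole
  support, so that \<open>f\<close> vanishes at this second restriction \<open>y'\<close>. A fresh element \<open>a\<close> that agrees
  with \<open>f\<close> on the support and at \<open>y'\<close> therefore cannot be among the states kept by \<open>y'\<close>; it is a
  companion of \<open>a0\<close>, and so \<open>f\<close> is nonzero at the first restriction.
\<close>

lemma restrict_to_companions_in_support:
  assumes x0: "x0 \<in> support" and a0: "a0 \<in> univ A" "\<forall>x\<in>support. x a0 = f x"
  shows "restrict_hom support (companions a0) x0 \<in> support"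
proof -
  let ?W = "letters_on support" and ?S = "states_on support" and ?C = "companions a0"
  have a0C: "a0 \<in> ?C" using agreeing_is_state[OF a0] by (auto simp: companions_def intro!: exI[of _ "{}"])
  have WS: "?W \<inter> ?S = {}"
    using x0 disjoint by (auto simp: letters_on_def states_on_def)
  define y where "y = restrict_hom support ?C x0"
  define y' where "y' = restrict_hom support (?S - ?C) x0"
  have y: "y \<in> X" and y': "y' \<in> X"
    using restrict_hom[OF support_subset x0] act_closed_companions
      act_closed_diff[OF support_subset act_closed_companions] by (auto simp: y_def y'_def)
  have "y' a0 = z" using a0C WS agreeing_is_state[OF a0] a0(1) by (auto simp: y'_def restrict_hom_def)
  then have fy': "f y' = z" using a0(2) y' by (metis (mono_tags, lifting) mem_Collect_eq support_def)
  obtain F where F: "finite F" "F \<subseteq> X"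
    "\<And>a x. \<lbrakk>a \<in> univ A; \<forall>y\<in>F. f y = y a; x \<in> X; f x \<in> Q\<rbrakk> \<Longrightarrow> f x = x a"
    using finite_test_set by metis
  obtain a where a: "a \<in> univ A" "f y = y a" "f y' = y' a" "\<forall>x\<in>F. f x = x a"
    using locally[of "insert y (insert y' F)"] F(1,2) y y' by auto
  have aV: "\<forall>x\<in>support. x a = f x"
  proof
    fix x assume "x \<in> support"
    then have "x \<in> X" "f x \<in> Q" using support_iff support_subset by auto
    then show "x a = f x" by (rule F(3)[OF a(1,4), symmetric])
  qed
  have nz: "x0 a \<noteq> z" using aV x0 by (auto simp: support_def)
  have "a \<in> ?C"
    using a fy' agreeing_is_state[OF a(1) aV] nz by (auto simp: y'_def restrict_hom_def split: if_splits)
  then have "f y = x0 a" using a by (auto simp: y_def restrict_hom_def)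
  then show ?thesis using nz y by (auto simp: support_def y_def)
qed

text \<open>
  Nonvanishing of \<open>f\<close> is monotone in the types of the members of \<open>G\<close>. Restrict \<open>y\<close> to the elements that
  have the same type, state or letter, at \<open>x\<close> and \<open>y\<close>. This changes nothing on \<open>G\<close>, so \<open>f\<close> is
  still nonzero, and an element that agrees with \<open>f\<close> there is a state at \<open>x\<close> as well.
\<close>

lemma type_matching_in_support:
  assumes y: "y \<in> support" and x: "x \<in> X"
    and types: "\<And>g. g \<in> G \<Longrightarrow> y g \<noteq> z \<Longrightarrow> (y g \<in> Q \<longleftrightarrow> x g \<in> Q) \<and> (y g \<in> \<Sigma> \<longleftrightarrow> x g \<in> \<Sigma>)"
  shows "x \<in> support"
proof -
  define U where "U = {x, y}"
  have yX: "y \<in> X" using y support_subset by auto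
  have U: "U \<subseteq> X" "y \<in> U" using x yX by (auto simp: U_def)
  define y1 where "y1 = restrict_hom U (states_on U) y"
  have y1: "y1 \<in> X" unfolding y1_def
    by (intro restrict_hom U act_closed_states_on)
  have "g \<in> letters_on U \<union> states_on U" if g: "g \<in> G" "y g \<noteq> z" for g
    using types[OF g] hom_mem[OF yX, of g] g G by (auto simp: U_def letters_on_def states_on_def univ_M)
  then have "f y1 = f y"
    using G by (intro supported y1 yX) (auto simp: y1_def restrict_hom_def)
  then have fy1: "f y1 \<in> Q" using support_iff[OF yX] y by simp
  obtain a where a: "a \<in> univ A" "f y1 = y1 a" "f x = x a"
    using locally[of "{y1, x}"] y1 x by auto
  have "a \<in> states_on U"
    using fy1 a U disjoint by (auto simp: y1_def restrict_hom_def letters_on_def split: if_splits)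
  then show ?thesis using a support_iff[OF x] by (auto simp: U_def states_on_def)
qed

text \<open>
  If \<open>a0 = s \<cdot> t\<close>, then \<open>t\<close> has the required values, as the value of a product is determined by its last
  factor; with a single state there is no choice of values.
\<close>

lemma exists_value_letter:
  assumes a0: "a0 \<in> univ A" "\<forall>x\<in>support. x a0 = f x"
    and prod: "a0 \<in> products \<or> Q = {q}" and ne: "letters_on support \<noteq> {}"
  shows "\<exists>t\<in>letters_on support. \<forall>x\<in>support. f x = c (x t)"
  using prod
proof
  assume "a0 \<in> products"
  then obtain s t where st: "s \<in> univ A" "t \<in> univ A" "a0 = prd A s t"
    by (auto simp: products_def)
  have "a0 \<in> states_on support" using a0 by (rule agreeing_is_state)
  then have t: "s \<in> states_on support" "t \<in> letters_on support"
    using st prd_states_on[OF support_subset] by auto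
  have "f x = c (x t)" if "x \<in> support" for x
    using a0(2) hom_prd[of x s t] t that support_subset st
    by (auto simp: states_on_def letters_on_def)
  then show ?thesis using t by blast
next
  assume Q: "Q = {q}"
  obtain t where t: "t \<in> letters_on support" using ne by auto
  have "f x = c (x t)" if x: "x \<in> support" for x
    using support_iff[of x] support_subset x t Q letter_value[of q "x t"]
    by (auto simp: letters_on_def)
  then show ?thesis using t by blast
qed

text \<open>
  Assembles the product that represents \<open>f\<close>. The test points \<open>F1\<close> make \<open>a0\<close> agree with \<open>f\<close> on the
  support; \<open>F2\<close> and \<open>y0\<close> make it a product unless there is only one state. If no element were a
  letter throughout the support, the restriction \<open>y\<close> to the companions would take no letter values,
  hence annihilate all products, and \<open>f\<close> would be the evaluation at a member of \<open>G\<close>.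
\<close>

lemma state_valued_evaluation: "is_evaluation A M f"
proof (cases "support = {}")
  case True
  obtain a where a: "a \<in> univ A" using locally[of "{}"] by auto
  \<comment> \<open>A square vanishes everywhere, since no value is both a state and a letter.\<close>
  show ?thesis unfolding is_evaluation_def
  proof (intro bexI[of _ "prd A a a"] ballI)
    fix x assume x: "x \<in> X"
    show "f x = x (prd A a a)"
      using hom_prd[OF x a a] True x disjoint by (auto simp: support_def)
  qed (rule prd_closed[OF a a])
next
  case False
  then obtain x0 where x0: "x0 \<in> support" by auto
  have x0X: "x0 \<in> X" "f x0 \<in> Q" using x0 support_iff support_subset by auto
  show ?thesis
  proof (rule ccontr)
    assume contra: "\<not> is_evaluation A M f"
    obtain F1 where F1: "finite F1" "F1 \<subseteq> X"
      "\<And>a x. \<lbrakk>a \<in> univ A; \<forall>y\<in>F1. f y = y a; x \<in> X; f x \<in> Q\<rbrakk> \<Longrightarrow> f x = x a"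
      using finite_test_set by metis
    obtain F2 where F2: "finite F2" "F2 \<subseteq> X" "\<And>g. g \<in> G \<Longrightarrow> \<exists>x\<in>F2. f x \<noteq> x g"
      using finite_refutation[OF contra] by metis
    obtain y0 where y0: "y0 \<in> X"
      "\<forall>a\<in>univ A. f y0 = y0 a \<longrightarrow> a \<in> G \<or> a \<in> products \<or> Q = {f x0}"
      using product_test_hom[OF x0X] by auto
    obtain a0 where a0: "a0 \<in> univ A" "f y0 = y0 a0" "\<forall>x\<in>F1. f x = x a0" "\<forall>x\<in>F2. f x = x a0"
      using locally[of "insert y0 (F1 \<union> F2)"] F1(1,2) F2(1,2) y0(1) by auto
    have a0V: "\<forall>x\<in>support. x a0 = f x"
    proof
      fix x assume "x \<in> support"
      then have "x \<in> X" "f x \<in> Q" using support_iff support_subset by auto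
      then show "x a0 = f x" by (rule F1(3)[OF a0(1,3), symmetric])
    qed
    have prod: "a0 \<in> products \<or> Q = {f x0}"
      using y0(2) a0 F2(3) by blast
    let ?W = "letters_on support" and ?C = "companions a0"
    define y where "y = restrict_hom support ?C x0"
    have y: "y \<in> support"
      unfolding y_def using restrict_to_companions_in_support[OF x0 a0(1) a0V] .
    then have yX: "y \<in> X" using support_subset by auto
    have WA: "?W \<subseteq> univ A" by (auto simp: letters_on_def)
    have CS: "?C \<subseteq> states_on support" by (auto simp: companions_def)
    have y_state: "y a \<in> Q \<longleftrightarrow> a \<in> ?C" and y_letter: "y a \<in> \<Sigma> \<longleftrightarrow> a \<in> ?W"
      if "a \<in> univ A" for a
      using that x0 CS disjoint
      by (auto simp: y_def restrict_hom_def letters_on_def states_on_def)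
    have "?W \<noteq> {}"
    proof
      assume "?W = {}"
      then have "is_evaluation A M f"
        using nonzero_at_null_hom[OF yX] y y_letter by (auto simp: support_def)
      then show False using contra by simp
    qed
    then obtain t where t: "t \<in> ?W" "\<And>x. x \<in> support \<Longrightarrow> f x = c (x t)"
      using exists_value_letter[OF a0(1) a0V prod] by blast
    obtain T where T: "finite T" "T \<subseteq> ?W"
      "\<forall>g\<in>G \<inter> ?C. \<forall>x\<in>X. (\<forall>t\<in>T. x t \<in> \<Sigma>) \<longrightarrow> (x g \<in> Q \<longleftrightarrow> x a0 \<in> Q)"
      using common_control[of "G \<inter> ?C" a0] G by auto
    \<comment> \<open>\<open>T\<close> makes the members of \<open>G \<inter> C\<close> states wherever \<open>a0\<close> is one; with \<open>G \<inter> W\<close>, the types of all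
      members of \<open>G\<close> that are nonzero at \<open>y\<close> are then controlled, where \<open>W\<close> denotes the letters on
      the support and \<open>C\<close> the companions of \<open>a0\<close>.\<close>
    define L where "L = (G \<inter> ?W) \<union> T"
    have L: "finite L" "L \<subseteq> ?W" using T G by (auto simp: L_def)
    obtain e where e: "e \<in> univ A" "\<forall>x\<in>X. x e \<in> Q \<longleftrightarrow> x a0 \<in> Q \<and> (\<forall>t\<in>L. x t \<in> \<Sigma>)"
      using exists_iterated_product[of L a0] L WA a0 by auto
    have tA: "t \<in> univ A" using t WA by auto
    have "f x = x (prd A e t)" if x: "x \<in> X" for x
    proof (cases "x \<in> support")
      case True
      then have "x a0 \<in> Q" using a0V support_iff[OF x] by simp
      moreover have "\<forall>t\<in>?W. x t \<in> \<Sigma>" using True by (auto simp: letters_on_def)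
      ultimately have "x e \<in> Q" "x t \<in> \<Sigma>" using e(2) x L t(1) by auto
      then show ?thesis using hom_prd[OF x e(1) tA] t(2)[OF True] by simp
    next
      case False
      have "x e \<notin> Q"
      proof
        assume "x e \<in> Q"
        then have *: "x a0 \<in> Q" "\<forall>t\<in>L. x t \<in> \<Sigma>" using e(2) x by auto
        have QC: "x g \<in> Q" if "g \<in> G \<inter> ?C" for g
          using T(3) x that * unfolding L_def by blast
        have SW: "x g \<in> \<Sigma>" if "g \<in> G \<inter> ?W" for g
          using that * by (auto simp: L_def)
        have "(y g \<in> Q \<longleftrightarrow> x g \<in> Q) \<and> (y g \<in> \<Sigma> \<longleftrightarrow> x g \<in> \<Sigma>)" if g: "g \<in> G" "y g \<noteq> z" for g
        proof -
          have gA: "g \<in> univ A" using g G by auto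
          then consider "g \<in> ?C" "y g \<in> Q" | "g \<in> ?W" "y g \<in> \<Sigma>"
            using hom_mem[OF yX gA] g y_state[OF gA] y_letter[OF gA] by (auto simp: univ_M)
          then show ?thesis
            using QC[of g] SW[of g] g disjoint by cases auto
        qed
        then have "x \<in> support" by (rule type_matching_in_support[OF y x])
        then show False using False by blast
      qed
      then show ?thesis using hom_prd[OF x e(1) tA] False x by (auto simp: support_def)
    qed
    then have "is_evaluation A M f"
      using e tA prd_closed unfolding is_evaluation_def by blast
    then show False using contra by simp
  qed
qed

end

theorem evaluation: "is_evaluation A M f"
  using letter_value_imp_evaluation state_valued_evaluation by blast

end

section \<open>Continuity and preservation of relations\<close>

lemma closedin_alg_hom:
  fixes A :: "'a binary_algebra" and M :: "'m binary_algebra"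
  assumes A: "is_algebra A" and M: "is_algebra M"
  shows "closedin (product_topology (\<lambda>_. discrete_topology (univ M)) (univ A)) (alg_hom A M)"
proof -
  let ?T = "product_topology (\<lambda>_::'a. discrete_topology (univ M)) (univ A)"
  let ?D = "discrete_topology (univ M)"
  have clA: "prd A u v \<in> univ A" if "u \<in> univ A" "v \<in> univ A" for u v
    using A that by (auto simp: is_algebra_def subuniverse_def)
  have clM: "prd M u v \<in> univ M" if "u \<in> univ M" "v \<in> univ M" for u v
    using M that by (auto simp: is_algebra_def subuniverse_def)
  have proj: "continuous_map ?T ?D (\<lambda>h. h u)" if "u \<in> univ A" for u
    using that by (rule continuous_map_product_projection)
  have "closedin ?T {h \<in> topspace ?T. h (prd A u v) = prd M (h u) (h v)}"
    if uv: "u \<in> univ A" "v \<in> univ A" for u v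
  proof (rule closedin_continuous_maps_eq)
    show "Hausdorff_space ?D" by (rule Hausdorff_space_discrete_topology)
    show "continuous_map ?T ?D (\<lambda>h. h (prd A u v))" using proj clA uv by blast
    have "continuous_map ?T (prod_topology ?D ?D) (\<lambda>h. (h u, h v))"
      using proj uv by (simp add: continuous_map_pairedI)
    moreover have "continuous_map (prod_topology ?D ?D) ?D (\<lambda>(m, n). prd M m n)"
      unfolding prod_topology_discrete_topology[symmetric] by (auto simp: clM)
    ultimately show "continuous_map ?T ?D (\<lambda>h. prd M (h u) (h v))"
      using continuous_map_compose by (fastforce simp: comp_def)
  qed
  then have "closedin ?T (\<Inter>(insert (topspace ?T)
      ((\<lambda>(u, v). {h \<in> topspace ?T. h (prd A u v) = prd M (h u) (h v)}) ` (univ A \<times> univ A))))"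
    by (intro closedin_Inter) (auto simp del: topspace_product_topology)
  moreover have "alg_hom A M = (\<Inter>(insert (topspace ?T)
      ((\<lambda>(u, v). {h \<in> topspace ?T. h (prd A u v) = prd M (h u) (h v)}) ` (univ A \<times> univ A))))"
    by (auto simp: alg_hom_def)
  ultimately show ?thesis by simp
qed

text \<open>
  Around each homomorphism, \<open>f\<close> is constant on a cylinder given by finitely many coordinates. Finitely
  many cylinders cover the space of homomorphisms, which is compact as a closed subset of a product of
  finite spaces, and the union of their sets of coordinates is as required.
\<close>

lemma continuous_imp_finitely_supported:
  fixes A :: "'a binary_algebra" and M :: "'m binary_algebra"
  assumes A: "is_algebra A" and M: "is_algebra M" and fin: "finite (univ M)"
    and f: "continuous_map (hom_topology A M) (discrete_topology (univ M)) f"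
  obtains G where "finite G" "G \<subseteq> univ A"
    "\<And>x y. \<lbrakk>x \<in> alg_hom A M; y \<in> alg_hom A M; \<forall>g\<in>G. x g = y g\<rbrakk> \<Longrightarrow> f x = f y"
proof -
  let ?T = "product_topology (\<lambda>_::'a. discrete_topology (univ M)) (univ A)"
  let ?X = "alg_hom A M"
  have XT: "?X \<subseteq> topspace ?T" by (auto simp: alg_hom_def)
  have compact: "compactin ?T ?X"
    using closedin_compact_space[OF _ closedin_alg_hom[OF A M]] fin
    by (auto simp: compact_space_product_topology compact_space_discrete_topology)
  define cyl where "cyl x H = {y \<in> topspace ?T. \<forall>g\<in>H. y g = x g}" for x :: "'a \<Rightarrow> 'm" and H
  have "\<exists>H. finite H \<and> H \<subseteq> univ A \<and> openin ?T (cyl x H) \<and> (\<forall>y\<in>cyl x H \<inter> ?X. f y = f x)"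
    if x: "x \<in> ?X" for x
  proof -
    have top: "topspace (hom_topology A M) = ?X" using XT by (auto simp: hom_topology_def)
    have "openin (hom_topology A M) {y \<in> topspace (hom_topology A M). f y \<in> {f x}}"
      using f x top continuous_map_image_subset_topspace[OF f]
      by (intro openin_continuous_map_preimage[OF f]) auto
    then obtain N where N: "openin ?T N" "{y \<in> ?X. f y = f x} = N \<inter> ?X"
      unfolding top by (auto simp: hom_topology_def openin_subtopology)
    have "x \<in> N" using N x by auto
    then obtain B where B: "finite {i \<in> univ A. B i \<noteq> topspace (discrete_topology (univ M))}"
      "\<forall>i\<in>univ A. openin (discrete_topology (univ M)) (B i)" "x \<in> Pi\<^sub>E (univ A) B"
      "Pi\<^sub>E (univ A) B \<subseteq> N"
      using N(1) unfolding openin_product_topology_alt by blast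
    define H where "H = {i \<in> univ A. B i \<noteq> univ M}"
    have H: "finite H" "H \<subseteq> univ A" using B by (auto simp: H_def)
    have sub: "cyl x H \<subseteq> N"
    proof
      fix y assume y: "y \<in> cyl x H"
      have "y i \<in> B i" if "i \<in> univ A" for i
        using y B(3) that by (cases "i \<in> H") (auto simp: cyl_def H_def PiE_iff)
      then have "y \<in> Pi\<^sub>E (univ A) B" using y by (auto simp: cyl_def PiE_iff)
      then show "y \<in> N" using B(4) by blast
    qed
    have "openin ?T (Pi\<^sub>E (univ A) (\<lambda>i. if i \<in> H then {x i} else univ M))"
      using H x by (subst openin_PiE_gen) (auto simp: alg_hom_def PiE_iff intro: finite_subset[of _ H])
    moreover have "Pi\<^sub>E (univ A) (\<lambda>i. if i \<in> H then {x i} else univ M) = cyl x H"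
    proof (rule set_eqI)
      fix y
      have "x i \<in> univ M" if "i \<in> univ A" for i using x that by (auto simp: alg_hom_def)
      then have "(\<forall>i\<in>univ A. y i \<in> (if i \<in> H then {x i} else univ M)) \<longleftrightarrow>
          (\<forall>i\<in>univ A. y i \<in> univ M) \<and> (\<forall>g\<in>H. y g = x g)"
        using H(2) by (metis singletonD singletonI subsetD)
      then show "y \<in> Pi\<^sub>E (univ A) (\<lambda>i. if i \<in> H then {x i} else univ M) \<longleftrightarrow> y \<in> cyl x H"
        by (auto simp: cyl_def PiE_iff)
    qed
    ultimately show ?thesis using H sub N by (intro exI[of _ H]) auto
  qed
  then obtain H where H: "\<And>x. x \<in> ?X \<Longrightarrow> finite (H x) \<and> H x \<subseteq> univ A \<and>
      openin ?T (cyl x (H x)) \<and> (\<forall>y\<in>cyl x (H x) \<inter> ?X. f y = f x)"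
    by metis
  have "\<And>U. U \<in> (\<lambda>x. cyl x (H x)) ` ?X \<Longrightarrow> openin ?T U"
    using H by blast
  moreover have "?X \<subseteq> \<Union>((\<lambda>x. cyl x (H x)) ` ?X)"
  proof
    fix x assume "x \<in> ?X"
    then have "x \<in> ?X" "x \<in> cyl x (H x)" using XT unfolding cyl_def by blast+
    then show "x \<in> \<Union>((\<lambda>x. cyl x (H x)) ` ?X)" by blast
  qed
  ultimately have "\<exists>\<F>. finite \<F> \<and> \<F> \<subseteq> (\<lambda>x. cyl x (H x)) ` ?X \<and> ?X \<subseteq> \<Union>\<F>"
    by (rule compactinD[OF compact])
  then obtain \<F> where \<F>: "finite \<F>" "\<F> \<subseteq> (\<lambda>x. cyl x (H x)) ` ?X" "?X \<subseteq> \<Union>\<F>"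
    by blast
  obtain F where F: "finite F" "F \<subseteq> ?X" "?X \<subseteq> (\<Union>x\<in>F. cyl x (H x))"
    using finite_subset_image[OF \<F>(1,2)] \<F>(3) by blast
  show thesis
  proof (rule that[of "\<Union>x\<in>F. H x"])
    show "finite (\<Union>x\<in>F. H x)" using F(1,2) H by blast
    show "(\<Union>x\<in>F. H x) \<subseteq> univ A" using F(2) H by blast
    fix x y assume xy: "x \<in> ?X" "y \<in> ?X" "\<forall>g\<in>\<Union>x\<in>F. H x. x g = y g"
    obtain w where w: "w \<in> F" "x \<in> cyl w (H w)" using F(3) xy(1) by blast
    have "y \<in> topspace ?T" using xy(2) XT by blast
    moreover have "y g = w g" if "g \<in> H w" for g
      using w xy(3) that by (force simp: cyl_def)
    ultimately have "y \<in> cyl w (H w)" unfolding cyl_def by blast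
    then have "f y = f w" "f x = f w" using H[of w] w F(2) xy(1,2) by blast+
    then show "f x = f y" by simp
  qed
qed

text \<open>
  With \<open>F = {w 0, \<dots>, w (k - 1)}\<close>, the relation \<open>R\<close> is the image of \<open>A\<close> under the homomorphism
  \<open>a \<mapsto> (w 0 a, \<dots>, w (k - 1) a)\<close>, hence compatible. As \<open>(w 0, \<dots>, w (k - 1))\<close> is pointwise in \<open>R\<close>,
  its image under \<open>f\<close> is in \<open>R\<close> as well.
\<close>

lemma preserving_imp_locally_evaluation:
  fixes A :: "'a binary_algebra" and M :: "'m binary_algebra"
  assumes A: "is_algebra A"
    and pres: "\<And>k R. compatible M k R \<Longrightarrow> preserves_relation A M f k R"
    and F: "finite F" "F \<subseteq> alg_hom A M" "F \<noteq> {}"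
  shows "\<exists>a\<in>univ A. \<forall>x\<in>F. f x = x a"
proof -
  obtain w :: "nat \<Rightarrow> 'a \<Rightarrow> 'm" where w: "bij_betw w {..<card F} F"
    using ex_bij_betw_nat_finite[OF F(1)] by (auto simp: atLeast0LessThan)
  define k where "k = card F"
  have k: "k \<ge> 1" using F by (simp add: k_def Suc_leI card_gt_0_iff)
  have wX: "w i \<in> alg_hom A M" if "i < k" for i
    using w that F by (auto simp: k_def bij_betw_def)
  have wval: "w i a \<in> univ M" if "i < k" "a \<in> univ A" for i a
    using wX[OF that(1)] that(2) by (auto simp: alg_hom_def)
  have wprd: "w i (prd A a b) = prd M (w i a) (w i b)" if "i < k" "a \<in> univ A" "b \<in> univ A" for i a b
    using wX[OF that(1)] that(2,3) by (simp add: alg_hom_def)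
  define R where "R = (\<lambda>a. \<lambda>i\<in>{..<k}. w i a) ` univ A"
  have "compatible M k R"
    unfolding compatible_def subuniverse_def
  proof (intro conjI ballI k)
    show "R \<subseteq> univ (direct_power M {..<k})"
      using wval by (auto simp: R_def direct_power_def split: if_splits)
    fix r r' assume "r \<in> R" "r' \<in> R"
    then obtain a b where ab: "a \<in> univ A" "b \<in> univ A"
      and r: "r = (\<lambda>i\<in>{..<k}. w i a)" "r' = (\<lambda>i\<in>{..<k}. w i b)" by (auto simp: R_def)
    have "prd (direct_power M {..<k}) r r' = (\<lambda>i\<in>{..<k}. w i (prd A a b))"
      using wprd[OF _ ab] by (auto simp: r direct_power_def fun_eq_iff)
    moreover have "prd A a b \<in> univ A" using A ab by (auto simp: is_algebra_def subuniverse_def)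
    ultimately show "prd (direct_power M {..<k}) r r' \<in> R" by (auto simp: R_def)
  qed
  then have "preserves_relation A M f k R" by (rule pres)
  moreover have "\<forall>a\<in>univ A. (\<lambda>i\<in>{..<k}. w i a) \<in> R" by (simp add: R_def)
  ultimately have "(\<lambda>i\<in>{..<k}. f (w i)) \<in> R"
    using wX unfolding preserves_relation_def by blast
  then obtain a where a: "a \<in> univ A" "(\<lambda>i\<in>{..<k}. f (w i)) = (\<lambda>i\<in>{..<k}. w i a)"
    by (auto simp: R_def)
  have "f (w i) = w i a" if "i < k" for i
    using fun_cong[OF a(2), of i] that by simp
  then have "\<forall>x\<in>w ` {..<k}. f x = x a" by auto
  moreover have "w ` {..<k} = F" using w by (simp add: k_def bij_betw_def)
  ultimately show ?thesis using a(1) by blast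
qed

theorem theorem4p1:
  fixes M :: "'m binary_algebra" and Q \<Sigma> :: "'m set" and z :: 'm
  assumes "total_automatic_algebra Q \<Sigma> z M"
    and "finite (univ M)"
    and "\<And>a. a \<in> \<Sigma> \<Longrightarrow> (\<lambda>q. prd M q a) constant_on Q"
  shows "dualizable TYPE('a) TYPE('i) M"
  unfolding dualizable_def
proof (intro allI impI, elim conjE)
  fix A :: "'a binary_algebra" and f
  assume isp: "in_ISP TYPE('i) M A"
    and cont: "continuous_map (hom_topology A M) (discrete_topology (univ M)) f"
    and pres: "\<forall>k R. compatible M k R \<longrightarrow> preserves_relation A M f k R"
  have A: "is_algebra A" using isp by (simp add: in_ISP_def)
  have aut: "automatic_algebra Q \<Sigma> z M" using assms(1) by (simp add: total_automatic_algebra_def)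
  have M: "is_algebra M"
    unfolding is_algebra_def subuniverse_def
  proof (intro conjI ballI subset_refl)
    fix m n assume "m \<in> univ M" "n \<in> univ M"
    moreover from this have "prd M m n \<in> Q \<union> {z}"
      using aut unfolding automatic_algebra_def by blast
    ultimately show "prd M m n \<in> univ M" using aut by (auto simp: automatic_algebra_def)
  qed
  have "\<forall>t\<in>\<Sigma>. \<exists>d. \<forall>q\<in>Q. prd M q t = d" using assms(3) by (auto simp: constant_on_def)
  then obtain c where c: "\<And>q t. \<lbrakk>q \<in> Q; t \<in> \<Sigma>\<rbrakk> \<Longrightarrow> prd M q t = c t" by metis
  interpret constant_letters M Q \<Sigma> z c A
  proof
    show "c t \<in> Q" if "q \<in> Q" "t \<in> \<Sigma>" for q t
    proof -
      have "prd M q t \<in> Q \<union> {z}" "prd M q t \<noteq> z"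
        using assms(1) that unfolding total_automatic_algebra_def automatic_algebra_def by blast+
      then show ?thesis using c[OF that] by simp
    qed
  qed (use aut c A in auto)
  obtain G where G: "finite G" "G \<subseteq> univ A"
    "\<And>x y. \<lbrakk>x \<in> alg_hom A M; y \<in> alg_hom A M; \<forall>g\<in>G. x g = y g\<rbrakk> \<Longrightarrow> f x = f y"
    using continuous_imp_finitely_supported[OF A M assms(2) cont] by metis
  have local_ev: "\<exists>a\<in>univ A. \<forall>x\<in>F. f x = x a" if "finite F" "F \<subseteq> X" for F
  proof -
    \<comment> \<open>Compatible relations have positive arity; the zero homomorphism makes the test set
      nonempty.\<close>
    have "\<exists>a\<in>univ A. \<forall>x\<in>insert (\<lambda>a\<in>univ A. z) F. f x = x a"
      using pres that zero_hom by (intro preserving_imp_locally_evaluation[OF A]) blast+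
    then show ?thesis by blast
  qed
  interpret local_evaluation M Q \<Sigma> z c A f G
    by unfold_locales (fact assms(2) G local_ev)+
  show "is_evaluation A M f" by (rule evaluation)
qed

end
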